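(* There exists a graph $G$ on $19$ vertices which is both $B_3$-free and $K_4$-free and satisfies $G \rightarrow (3,3)^v$. Consequently $F_v(K_3,K_3;B_3) \le 19$.
   Context: All graphs are finite, undirected and simple. $K_n$ is the complete graph on $n$ vertices. The join $G+H$ of vertex-disjoint graphs is their union together with all edges between $V(G)$ and $V(H)$. The book graph $B_k$ is $K_1 + K_{1,k}$ ($k$ triangles sharing a common edge); so $B_3$ has $5$ vertices. A graph is $H$-free if it contains no subgraph isomorphic to $H$. $G \rightarrow (3,3)^v$ means every red-blue coloring of the vertices of $G$ contains a monochromatic triangle $K_3$. $F_v(K_3,K_3;H)$ is the smallest $n$ such that some $H$-free graph on $n$ vertices satisfies $G \rightarrow (3,3)^v$. *)

theory Defs
  imports "Graph_Theory.Graph_Theory" "HOL-Library.Extended_Nat"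
begin

text \<open>
  A finite simple undirected graph is a \<open>pair_graph\<close>: finite, loop-free and symmetric,
  so an undirected edge between \<open>u\<close> and \<open>v\<close> is the pair of arcs \<open>(u, v)\<close>, \<open>(v, u)\<close>.
\<close>

definition complete_graph :: "nat \<Rightarrow> nat pair_pre_digraph" where
  "complete_graph n = \<lparr> pverts = {..<n}, parcs = {(u, v). u < n \<and> v < n \<and> u \<noteq> v} \<rparr>"

definition complete_bipartite_graph :: "nat \<Rightarrow> nat \<Rightarrow> (nat + nat) pair_pre_digraph" where
  "complete_bipartite_graph m n =
    \<lparr> pverts = {..<m} <+> {..<n},
      parcs = (Inl ` {..<m}) \<times> (Inr ` {..<n}) \<union> (Inr ` {..<n}) \<times> (Inl ` {..<m}) \<rparr>"

text \<open>The sum type makes the vertex sets of the two summands of a join disjoint.\<close>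

definition graph_join ::
    "'a pair_pre_digraph \<Rightarrow> 'b pair_pre_digraph \<Rightarrow> ('a + 'b) pair_pre_digraph" where
  "graph_join G H =
    \<lparr> pverts = pverts G <+> pverts H,
      parcs = map_prod Inl Inl ` parcs G \<union> map_prod Inr Inr ` parcs H
        \<union> (Inl ` pverts G) \<times> (Inr ` pverts H) \<union> (Inr ` pverts H) \<times> (Inl ` pverts G) \<rparr>"

definition book_graph :: "nat \<Rightarrow> (nat + (nat + nat)) pair_pre_digraph" where
  "book_graph k = graph_join (complete_graph 1) (complete_bipartite_graph 1 k)"

text \<open>Subgraphs are not required to be induced.\<close>

definition is_copy_in ::
    "('a, 'a \<times> 'a) pre_digraph \<Rightarrow> 'b pair_pre_digraph \<Rightarrow> 'a pair_pre_digraph \<Rightarrow> bool" where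
  "is_copy_in S H G \<longleftrightarrow> subgraph S (with_proj G) \<and> digraph_iso S (with_proj H)"

definition graph_free :: "'b pair_pre_digraph \<Rightarrow> 'a pair_pre_digraph \<Rightarrow> bool" where
  "graph_free H G \<longleftrightarrow> \<not> (\<exists>S. is_copy_in S H G)"

datatype color = Red | Blue

text \<open>
  Every red-blue coloring of the vertices of \<open>G\<close> contains a red \<open>H\<^sub>1\<close> or a blue \<open>H\<^sub>2\<close>.
  For \<open>H\<^sub>1 = H\<^sub>2 = K\<^sub>3\<close> this is \<open>G \<rightarrow> (3,3)\<^sup>v\<close>. Colors assigned outside \<open>pverts G\<close> are irrelevant.
\<close>

definition vertex_arrows ::
    "'a pair_pre_digraph \<Rightarrow> 'b pair_pre_digraph \<Rightarrow> 'c pair_pre_digraph \<Rightarrow> bool" where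
  "vertex_arrows G H\<^sub>1 H\<^sub>2 \<longleftrightarrow>
    (\<forall>c :: 'a \<Rightarrow> color.
      (\<exists>S. is_copy_in S H\<^sub>1 G \<and> (\<forall>v \<in> verts S. c v = Red)) \<or>
      (\<exists>S. is_copy_in S H\<^sub>2 G \<and> (\<forall>v \<in> verts S. c v = Blue)))"

text \<open>
  The vertex Folkman number \<open>F\<^sub>v(H\<^sub>1, H\<^sub>2; H)\<close>. Every finite graph is isomorphic to one with
  vertices in \<open>nat\<close>. The value is \<open>\<infinity>\<close> if no suitable graph exists; otherwise the infimum
  is attained.
\<close>

definition vertex_folkman ::
    "'a pair_pre_digraph \<Rightarrow> 'b pair_pre_digraph \<Rightarrow> 'c pair_pre_digraph \<Rightarrow> enat" where
  "vertex_folkman H\<^sub>1 H\<^sub>2 H =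
    Inf {enat (card (pverts G)) | G :: nat pair_pre_digraph.
      pair_graph G \<and> graph_free H G \<and> vertex_arrows G H\<^sub>1 H\<^sub>2}"

lemma complete_digraph_complete_graph: "K\<^bsub>n\<^esub> (with_proj (complete_graph n))"
  by (auto simp: complete_digraph_pair_def complete_graph_def)

lemma complete_bipartite_digraph_complete_bipartite_graph:
  "K\<^bsub>m,n\<^esub> (with_proj (complete_bipartite_graph m n))"
  unfolding complete_bipartite_digraph_pair_def complete_bipartite_graph_def
proof (intro conjI exI)
  let ?U = "Inl ` {..<m} :: (nat + nat) set" and ?V = "Inr ` {..<n} :: (nat + nat) set"
  let ?G = "\<lparr>pverts = {..<m} <+> {..<n}, parcs = ?U \<times> ?V \<union> ?V \<times> ?U\<rparr>"
  show "finite (pverts ?G)" by simp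
  show "pverts ?G = ?U \<union> ?V" by (simp add: Plus_def)
  show "?U \<inter> ?V = {}" by auto
  show "card ?U = m" "card ?V = n" by (simp_all add: card_image)
  show "parcs ?G = ?U \<times> ?V \<union> ?V \<times> ?U" by simp
qed

lemma pair_graph_join:
  assumes "pair_graph G" "pair_graph H"
  shows "pair_graph (graph_join G H)"
proof -
  interpret G: pair_graph G by fact
  interpret H: pair_graph H by fact
  have fin: "finite (pverts G)" "finite (pverts H)" "finite (parcs G)" "finite (parcs H)"
    by (simp_all add: G.pair_finite_verts H.pair_finite_verts G.pair_finite_arcs H.pair_finite_arcs)
  have sym: "sym (parcs G)" "sym (parcs H)"
    using G.pair_sym_arcs H.pair_sym_arcs by (simp_all add: symmetric_def)
  show ?thesis
  proof unfold_locales
    show "symmetric (with_proj (graph_join G H))"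
      using sym by (force simp: symmetric_def graph_join_def sym_def)
  qed (use fin in \<open>auto simp: graph_join_def dest: G.wellformed' H.wellformed' G.pair_no_loops H.pair_no_loops\<close>)
qed

lemma pair_graph_book: "pair_graph (book_graph k)"
  unfolding book_graph_def
  by (rule pair_graph_join[OF pair_graphI_complete[OF complete_digraph_complete_graph]
        pair_graphI_complete_bipartite[OF complete_bipartite_digraph_complete_bipartite_graph]])

lemma card_book: "card (pverts (book_graph k)) = k + 2"
  by (simp add: book_graph_def graph_join_def complete_graph_def complete_bipartite_graph_def
      card_Plus)

end

theory Submission
  imports Defs
begin

text \<open>
  The witness has vertices \<open>a\<^sub>i\<close>, \<open>b\<^sub>i\<close> for \<open>i\<close> modulo 9 and an apex, with the apex adjacent to all
  \<open>a\<^sub>i\<close>, and with \<open>a\<^sub>i \<sim> a\<^sub>i\<^sub>+\<^sub>2\<close>, \<open>b\<^sub>i \<sim> b\<^sub>i\<^sub>+\<^sub>1, b\<^sub>i\<^sub>+\<^sub>3\<close> and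
  \<open>a\<^sub>i \<sim> b\<^sub>i, b\<^sub>i\<^sub>+\<^sub>1, b\<^sub>i\<^sub>+\<^sub>3\<close>. It was found by a computer search over graphs with this
  rotational symmetry. Every edge lies in at most two triangles, which excludes \<open>B\<^sub>3\<close>, and its
  common neighbours are nonadjacent, which excludes \<open>K\<^sub>4\<close>. That no 2-coloring avoids all 39
  triangles is a small propositional unsatisfiability problem.
\<close>

text \<open>Replaces isomorphisms with separate vertex and arc maps by a plain arc-preserving
  injection. The isomorphism in \<open>is_copy_in\<close> runs from \<open>S\<close> to
  \<open>H\<close>, so \<open>f\<close> is the inverse of its vertex map.\<close>

lemma is_copy_inE:
  assumes "is_copy_in S H G"
  obtains f where "inj_on f (pverts H)" "f ` pverts H \<subseteq> pverts G"
    "\<And>u v. (u, v) \<in> parcs H \<Longrightarrow> (f u, f v) \<in> parcs G"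
proof -
  from assms obtain h where sub: "subgraph S (with_proj G)"
    and iso: "pre_digraph.digraph_isomorphism S h" and H: "with_proj H = app_iso h S"
    unfolding is_copy_in_def digraph_iso_def by blast
  define f where "f = inv_into (verts S) (iso_verts h)"
  from sub have S: "verts S \<subseteq> pverts G" "arcs S \<subseteq> parcs G" "tail S = fst" "head S = snd" "wf_digraph S"
    by (auto simp: subgraph_def compatible_def)
  have pv: "pverts H = iso_verts h ` verts S" and pa: "parcs H = iso_arcs h ` arcs S"
    and th: "iso_tail h = fst" "iso_head h = snd"
    using arg_cong[OF H, of verts] arg_cong[OF H, of arcs] arg_cong[OF H, of tail] arg_cong[OF H, of head]
    by simp_all
  from iso have inj: "inj_on (iso_verts h) (verts S)"
    and ends: "\<And>a. a \<in> arcs S \<Longrightarrow> iso_verts h (fst a) = fst (iso_arcs h a) \<and>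
      iso_verts h (snd a) = snd (iso_arcs h a)"
    unfolding pre_digraph.digraph_isomorphism_def S th by auto
  show thesis
  proof
    show "inj_on f (pverts H)" unfolding pv f_def by (simp add: inj_on_inv_into)
    show "f ` pverts H \<subseteq> pverts G"
      using S(1) inj unfolding pv f_def by auto
    fix u v assume "(u, v) \<in> parcs H"
    then obtain a where a: "a \<in> arcs S" "iso_arcs h a = (u, v)" unfolding pa by auto
    with S have "fst a \<in> verts S" "snd a \<in> verts S"
      by (metis wf_digraph.tail_in_verts, metis wf_digraph.head_in_verts)
    with a ends[OF a(1)] inj have "f u = fst a" "f v = snd a" unfolding f_def
      by (auto simp: inv_into_f_eq)
    with a S show "(f u, f v) \<in> parcs G" by auto
  qed
qed

text \<open>Converse of \<open>is_copy_inE\<close>, with an explicit copy so that its vertex set is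
  known when colors are checked. The obvious isomorphism maps \<open>H\<close> onto the image,
  opposite to the direction in \<open>is_copy_in\<close>, and is inverted by
  \<open>digraph_iso_swap\<close>.\<close>

lemma is_copy_in_image:
  assumes "pair_wf_digraph G" "pair_wf_digraph H"
    and "inj_on f (pverts H)" "f ` pverts H \<subseteq> pverts G"
    and "\<And>u v. (u, v) \<in> parcs H \<Longrightarrow> (f u, f v) \<in> parcs G"
  shows "is_copy_in (with_proj \<lparr>pverts = f ` pverts H, parcs = map_prod f f ` parcs H\<rparr>) H G"
proof -
  interpret G: pair_wf_digraph G by fact
  interpret H: pair_wf_digraph H by fact
  let ?S = "\<lparr>pverts = f ` pverts H, parcs = map_prod f f ` parcs H\<rparr>"
  interpret S: pair_wf_digraph ?S
    by unfold_locales (auto dest: H.in_arcsD1 H.in_arcsD2)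
  have sub: "subgraph (with_proj ?S) (with_proj G)"
    using assms(4,5) G.wf_digraph S.wf_digraph unfolding subgraph_def compatible_def by auto
  let ?h = "\<lparr>iso_verts = f, iso_arcs = map_prod f f, iso_head = snd, iso_tail = fst\<rparr>"
  have "inj_on (map_prod f f) (parcs H)"
    using map_prod_inj_on[OF assms(3) assms(3)]
    by (rule inj_on_subset) (auto dest: H.in_arcsD1 H.in_arcsD2)
  then have "pre_digraph.digraph_isomorphism (with_proj H) ?h"
    unfolding pre_digraph.digraph_isomorphism_def using H.wf_digraph assms(3) by auto
  moreover have "with_proj ?S = app_iso ?h (with_proj H)"
    by (simp add: app_iso_def with_proj_def)
  ultimately have "digraph_iso (with_proj H) (with_proj ?S)"
    unfolding digraph_iso_def by blast
  then have "digraph_iso (with_proj ?S) (with_proj H)"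
    by (rule digraph_iso_swap[OF H.wf_digraph])
  with sub show ?thesis unfolding is_copy_in_def by blast
qed

lemma pair_wf_digraph_complete_graph: "pair_wf_digraph (complete_graph n)"
  by unfold_locales (auto simp: complete_graph_def)

text \<open>The vertex \<open>a\<^sub>i\<close> is \<open>i\<close>, the vertex \<open>b\<^sub>i\<close> is \<open>9 + i\<close>, and the apex is 18.\<close>

definition nbrs :: "nat \<Rightarrow> nat list" where
  "nbrs u =
    (if u < 9 then
       [18, (u + 2) mod 9, (u + 7) mod 9, 9 + u, 9 + (u + 1) mod 9, 9 + (u + 3) mod 9]
     else if u < 18 then
       [u mod 9, (u + 8) mod 9, (u + 6) mod 9,
        9 + (u + 1) mod 9, 9 + (u + 8) mod 9, 9 + (u + 3) mod 9, 9 + (u + 6) mod 9]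
     else [0..<9])"

definition graph19 :: "nat pair_pre_digraph" where
  "graph19 = \<lparr>pverts = {..<19}, parcs = {(u, v). u < 19 \<and> v \<in> set (nbrs u)}\<rparr>"

text \<open>Passing to a list makes the finite checks below executable for
  \<open>code_simp\<close>.\<close>

lemma all_less_19: "(\<forall>u<19. P u) \<longleftrightarrow> list_all P [0..<19]"
  by (auto simp: list_all_iff)

lemma nbrs_irrefl_sym:
  "\<forall>u<19. list_all (\<lambda>v. v < 19 \<and> v \<noteq> u \<and> u \<in> set (nbrs v)) (nbrs u)"
  unfolding all_less_19 by code_simp

text \<open>One evaluation serves both exclusions: B_3 needs three common neighbors of its shared
  edge, and K_4 needs two adjacent common neighbors of an edge.\<close>

lemma nbrs_common:
  "\<forall>u<19. list_all (\<lambda>v. let ws = filter (\<lambda>w. w \<in> set (nbrs v)) (nbrs u)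
     in length ws \<le> 2 \<and> list_all (\<lambda>w. list_all (\<lambda>x. x \<notin> set (nbrs w)) ws) ws) (nbrs u)"
  unfolding all_less_19 by code_simp

text \<open>Five orbits under rotation. The last has only three members, each listed three times, so
  the 45 entries are 39 distinct triangles.\<close>

definition triangles :: "(nat \<times> nat \<times> nat) list" where
  "triangles = concat (map (\<lambda>i.
    [(18, i, (i + 2) mod 9),
     (i, (i + 2) mod 9, 9 + (i + 3) mod 9),
     (i, 9 + i, 9 + (i + 1) mod 9),
     (i, 9 + i, 9 + (i + 3) mod 9),
     (9 + i, 9 + (i + 3) mod 9, 9 + (i + 6) mod 9)]) [0..<9])"

lemma triangles_nbrs:
  "list_all (\<lambda>(u, v, w). u < 19 \<and> v < 19 \<and> v \<in> set (nbrs u) \<and> w \<in> set (nbrs u) \<and> w \<in> set (nbrs v))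
    triangles"
  by code_simp

lemma monochromatic_triangle:
  fixes P :: "nat \<Rightarrow> bool"
  shows "\<exists>(u, v, w) \<in> set triangles. P u = P v \<and> P v = P w"
proof (rule ccontr)
  have upt: "[0..<9] = [0, 1, 2, 3, 4, 5, 6, 7, 8]"
    by code_simp
  assume "\<not> ?thesis"
  then have "\<forall>(u, v, w) \<in> set triangles. \<not> (P u = P v \<and> P v = P w)"
    by blast
  then show False
    \<comment> \<open>Evaluating the indices leaves a propositional problem over \<open>P 0\<close>
      to \<open>P 18\<close>. The flipped equation turns \<open>Suc (Suc 0)\<close> into
      \<open>2\<close>, so that each vertex has a single name.\<close>
    unfolding triangles_def upt by (simp flip: numeral_2_eq_2) sat
qed

theorem theorem5:
  shows "(\<exists>G :: nat pair_pre_digraph.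
      pair_graph G \<and> card (pverts G) = 19 \<and>
      graph_free (book_graph 3) G \<and> graph_free (complete_graph 4) G \<and>
      vertex_arrows G (complete_graph 3) (complete_graph 3)) \<and>
    vertex_folkman (complete_graph 3) (complete_graph 3) (book_graph 3) \<le> 19"
proof -
  let ?G = graph19
  have parcs: "(u, v) \<in> parcs ?G \<longleftrightarrow> u < 19 \<and> v \<in> set (nbrs u)" for u v
    by (simp add: graph19_def)
  have pverts: "pverts ?G = {..<19}" by (simp add: graph19_def)
  have arcD: "u < 19" "v < 19" "u \<noteq> v" "(v, u) \<in> parcs ?G" if "(u, v) \<in> parcs ?G" for u v
    using that nbrs_irrefl_sym by (auto simp: parcs list_all_iff)
  have no_loop: "(u, u) \<notin> parcs ?G" for u
    using arcD(3) by blast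
  have pg: "pair_graph ?G"
  proof unfold_locales
    have "parcs ?G \<subseteq> {..<19} \<times> {..<19}" by (auto dest: arcD)
    then show "finite (parcs ?G)" by (rule finite_subset) simp
    show "symmetric (with_proj ?G)" by (auto simp: symmetric_def sym_def dest: arcD)
  qed (auto simp: pverts dest: arcD)
  then have wf: "pair_wf_digraph ?G" by (simp add: pair_graph_def pair_digraph_def pair_fin_digraph_def)
  define ws where "ws u v = filter (\<lambda>w. w \<in> set (nbrs v)) (nbrs u)" for u v
  have common: "w \<in> set (ws u v)" if "(u, w) \<in> parcs ?G" "(v, w) \<in> parcs ?G" for u v w
    using that by (simp add: ws_def parcs)
  have ws: "length (ws u v) \<le> 2" "\<And>w x. w \<in> set (ws u v) \<Longrightarrow> x \<in> set (ws u v) \<Longrightarrow> (w, x) \<notin> parcs ?G"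
    if "(u, v) \<in> parcs ?G" for u v
    using that nbrs_common unfolding ws_def by (auto simp: parcs list_all_iff Let_def)
  have book: "graph_free (book_graph 3) ?G"
    unfolding graph_free_def
  proof
    assume "\<exists>S. is_copy_in S (book_graph 3) ?G"
    then obtain S where "is_copy_in S (book_graph 3) ?G" ..
    then obtain f where inj: "inj_on f (pverts (book_graph 3))"
      and arc: "\<And>u v. (u, v) \<in> parcs (book_graph 3) \<Longrightarrow> (f u, f v) \<in> parcs ?G"
      by (rule is_copy_inE) blast
    \<comment> \<open>The vertex \<open>?u\<close> of K_1 and the center \<open>?v\<close> of the
      star K_1,3 span the shared edge of the book. The leaves \<open>?p i\<close> complete its three
      triangles.\<close>
    let ?u = "Inl 0 :: nat + nat + nat" and ?v = "Inr (Inl 0) :: nat + nat + nat"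
    let ?p = "\<lambda>i. Inr (Inr i) :: nat + nat + nat"
    have uv: "(f ?u, f ?v) \<in> parcs ?G"
      by (rule arc) (auto simp: book_graph_def graph_join_def complete_graph_def complete_bipartite_graph_def)
    have "f (?p i) \<in> set (ws (f ?u) (f ?v))" if "i < 3" for i
      using that by (intro common arc)
        (force simp: book_graph_def graph_join_def complete_graph_def complete_bipartite_graph_def)+
    then have "(f \<circ> ?p) ` {..<3} \<subseteq> set (ws (f ?u) (f ?v))" by auto
    then have "card ((f \<circ> ?p) ` {..<3}) \<le> card (set (ws (f ?u) (f ?v)))"
      by (rule card_mono[rotated]) simp
    moreover have "inj_on (f \<circ> ?p) {..<3}"
      using inj by (auto simp: inj_on_def book_graph_def graph_join_def complete_bipartite_graph_def)
    then have "card ((f \<circ> ?p) ` {..<3}) = 3"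
      by (simp only: card_image card_lessThan)
    ultimately show False
      using ws(1)[OF uv] card_length[of "ws (f ?u) (f ?v)"] by linarith
  qed
  have k4: "graph_free (complete_graph 4) ?G"
    unfolding graph_free_def
  proof
    assume "\<exists>S. is_copy_in S (complete_graph 4) ?G"
    then obtain S where "is_copy_in S (complete_graph 4) ?G" ..
    then obtain f where arc: "\<And>u v. (u, v) \<in> parcs (complete_graph 4) \<Longrightarrow> (f u, f v) \<in> parcs ?G"
      by (rule is_copy_inE) blast
    have "(f i, f j) \<in> parcs ?G" if "i < 4" "j < 4" "i \<noteq> j" for i j
      using that by (intro arc) (simp add: complete_graph_def)
    \<comment> \<open>\<open>f 2\<close> and \<open>f 3\<close> are adjacent common neighbors of the
      edge between \<open>f 0\<close> and \<open>f 1\<close>.\<close>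
    then show False
      using ws(2)[of "f 0" "f 1" "f 2" "f 3"] common by simp
  qed
  have arr: "vertex_arrows ?G (complete_graph 3) (complete_graph 3)"
    unfolding vertex_arrows_def
  proof
    fix c :: "nat \<Rightarrow> color"
    \<comment> \<open>A vertex that is not red is blue, so agreement on being red is agreement in
      color, and both colors are handled at once.\<close>
    obtain u v w where arcs: "(u, v) \<in> parcs ?G" "(u, w) \<in> parcs ?G" "(v, w) \<in> parcs ?G"
      and mono: "(c u = Red) = (c v = Red)" "(c v = Red) = (c w = Red)"
      using monochromatic_triangle[of "\<lambda>v. c v = Red"] triangles_nbrs
      by (fastforce simp: parcs list_all_iff)
    define f where "f i = [u, v, w] ! i" for i :: nat
    have lt3: "i < 3 \<longleftrightarrow> i = 0 \<or> i = 1 \<or> i = 2" for i :: nat by auto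
    \<comment> \<open>The listed triangle supplies three arcs; \<open>arcD(4)\<close> reverses them,
      giving all six arcs of K_3.\<close>
    have f_arc: "\<forall>i<3. \<forall>j<3. i \<noteq> j \<longrightarrow> (f i, f j) \<in> parcs ?G"
      using arcs arcs[THEN arcD(4)] by (simp add: f_def numeral_3_eq_3 All_less_Suc)
    note f = f_def lt3 complete_graph_def
    let ?S = "with_proj \<lparr>pverts = f ` pverts (complete_graph 3), parcs = map_prod f f ` parcs (complete_graph 3)\<rparr>"
    have copy: "is_copy_in ?S (complete_graph 3) ?G"
    proof (rule is_copy_in_image[OF wf pair_wf_digraph_complete_graph])
      show "inj_on f (pverts (complete_graph 3))"
        using arcs no_loop by (auto simp: inj_on_def f)
      show "f ` pverts (complete_graph 3) \<subseteq> pverts ?G"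
        using arcs[THEN arcD(1)] arcs[THEN arcD(2)] by (auto simp: f pverts)
      show "(f i, f j) \<in> parcs ?G" if "(i, j) \<in> parcs (complete_graph 3)" for i j
        using that f_arc by (simp add: complete_graph_def)
    qed
    have "c v = c u" "c w = c u"
      using mono by (metis color.exhaust)+
    then have "\<forall>x\<in>verts ?S. c x = c u"
      by (auto simp: f)
    then have "(\<forall>x\<in>verts ?S. c x = Red) \<or> (\<forall>x\<in>verts ?S. c x = Blue)"
      by (cases "c u") simp_all
    with copy show "(\<exists>S. is_copy_in S (complete_graph 3) ?G \<and> (\<forall>v\<in>verts S. c v = Red)) \<or>
      (\<exists>S. is_copy_in S (complete_graph 3) ?G \<and> (\<forall>v\<in>verts S. c v = Blue))"
      by blast
  qed
  have card: "card (pverts ?G) = 19" by (simp add: pverts)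
  \<comment> \<open>The order of the witness belongs to the set whose infimum is the Folkman
    number.\<close>
  have "vertex_folkman (complete_graph 3) (complete_graph 3) (book_graph 3) \<le> enat (card (pverts ?G))"
    unfolding vertex_folkman_def using pg book arr by (intro Inf_lower) blast
  then show ?thesis
    using pg card book k4 arr by (metis numeral_eq_enat)
qed

end
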